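(* Let $W_{(\alpha,\beta)}$ be a spherically quasinormal $2$-variable weighted shift with constant of spherical quasinormality $c>0$, and let $\mu$ be its Berger measure. Let $W_0$ be the unilateral weighted shift with weights $\alpha_{(0,0)},\alpha_{(1,0)},\alpha_{(2,0)},\dots$, and let $\sigma$ be its Berger measure. Assume that $W_0$ is recursively generated, with $$\sigma=\rho_0\delta_{s_0}+\cdots+\rho_{r-1}\delta_{s_{r-1}},$$ where $0\le s_0<\cdots<s_{r-1}\le c$, $\rho_0,\dots,\rho_{r-1}>0$, and $\rho_0+\cdots+\rho_{r-1}=1$. Then $$\mu=\rho_0\delta_{(s_0,c-s_0)}+\cdots+\rho_{r-1}\delta_{(s_{r-1},c-s_{r-1})}.$$
   Context: $\mathbb{Z}_+=\{0,1,2,\dots\}$; $\delta_x$ is the point mass at $x$. A unilateral weighted shift $W_\omega$ with bounded positive weights $\omega=\{\omega_n\}$ acts on $\ell^2(\mathbb{Z}_+)$ by $W_\omega e_n=\omega_ne_{n+1}$; its moments are $\gamma_0=1$, $\gamma_k=\omega_0^2\cdots\omega_{k-1}^2$. $W_\omega$ is subnormal iff there is a probability measure $\sigma$ on $[0,\|W_\omega\|^2]$ (its Berger measure) with $\gamma_k=\int s^kd\sigma(s)$ for all $k\ge0$. A subnormal unilateral weighted shift is recursively generated if there are $k\ge1$ and real $\varphi_0,\dots,\varphi_{k-1}$ with $\gamma_{n+k}=\varphi_0\gamma_n+\cdots+\varphi_{k-1}\gamma_{n+k-1}$ for all $n\ge0$; equivalently, its Berger measure is finitely atomic. A $2$-variable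 weighted shift $W_{(\alpha,\beta)}\equiv(T_1,T_2)$, with bounded positive weights $\alpha_{\mathbf k},\beta_{\mathbf k}$ ($\mathbf k\in\mathbb{Z}_+^2$), acts on $\ell^2(\mathbb{Z}_+^2)$ by $T_1e_{\mathbf k}=\alpha_{\mathbf k}e_{\mathbf k+(1,0)}$, $T_2e_{\mathbf k}=\beta_{\mathbf k}e_{\mathbf k+(0,1)}$, and is assumed commuting. Its moment $\gamma_{(k_1,k_2)}$ is the product of the squares of the weights along any nondecreasing lattice path from $(0,0)$ to $(k_1,k_2)$. It is (jointly) subnormal iff there is a probability measure $\mu$ on $[0,\|T_1\|^2]\times[0,\|T_2\|^2]$ (its Berger measure) with $\gamma_{(k_1,k_2)}=\int s^{k_1}t^{k_2}d\mu(s,t)$ for all $k_1,k_2\ge0$. $W_{(\alpha,\beta)}$ is spherically quasinormal if $T_1,T_2$ commute with $T_1^*T_1+T_2^*T_2$; for $2$-variable weighted shifts this is equivalent to $\alpha_{\mathbf k}^2+\beta_{\mathbf k}^2=c$ for all $\mathbf k\in\mathbb{Z}_+^2$ and some constant $c>0$, called the constant of spherical quasinormality. Every spherically quasinormal $2$-variable weighted shift is subnormal, so $\mu$ exists, and then $W_0$ is subnormal, so $\sigma$ exists. *)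

theory Defs
  imports "HOL-Probability.Probability"
begin

section \<open>Square-summable families and operators on them\<close>

definition ell2 :: "('a \<Rightarrow> complex) set" where
  "ell2 = {f. (\<lambda>k. (cmod (f k))\<^sup>2) summable_on UNIV}"

definition ell2_inner :: "('a \<Rightarrow> complex) \<Rightarrow> ('a \<Rightarrow> complex) \<Rightarrow> complex" where
  "ell2_inner f g = (\<Sum>\<^sub>\<infinity>k. f k * cnj (g k))"

definition ell2_norm :: "('a \<Rightarrow> complex) \<Rightarrow> real" where
  "ell2_norm f = sqrt (\<Sum>\<^sub>\<infinity>k. (cmod (f k))\<^sup>2)"

definition ell2_onorm :: "(('a \<Rightarrow> complex) \<Rightarrow> ('b \<Rightarrow> complex)) \<Rightarrow> real" where
  "ell2_onorm T = Sup {ell2_norm (T f) | f. f \<in> ell2 \<and> ell2_norm f \<le> 1}"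

definition is_adjoint ::
  "(('a \<Rightarrow> complex) \<Rightarrow> ('a \<Rightarrow> complex)) \<Rightarrow> (('a \<Rightarrow> complex) \<Rightarrow> ('a \<Rightarrow> complex)) \<Rightarrow> bool" where
  "is_adjoint T S \<longleftrightarrow> S ` ell2 \<subseteq> ell2 \<and>
     (\<forall>f\<in>ell2. \<forall>g\<in>ell2. ell2_inner (T f) g = ell2_inner f (S g))"

definition commute_on_ell2 ::
  "(('a \<Rightarrow> complex) \<Rightarrow> ('a \<Rightarrow> complex)) \<Rightarrow> (('a \<Rightarrow> complex) \<Rightarrow> ('a \<Rightarrow> complex)) \<Rightarrow> bool" where
  "commute_on_ell2 S T \<longleftrightarrow> (\<forall>f\<in>ell2. S (T f) = T (S f))"

text \<open>Adjoints are only determined on \<open>ell2\<close>, so \<open>S1\<close> and \<open>S2\<close> below are the adjoints of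
  \<open>T1\<close> and \<open>T2\<close>, uniquely as far as the commutation relations are concerned.\<close>

definition spherically_quasinormal ::
  "(('a \<Rightarrow> complex) \<Rightarrow> ('a \<Rightarrow> complex)) \<Rightarrow> (('a \<Rightarrow> complex) \<Rightarrow> ('a \<Rightarrow> complex)) \<Rightarrow> bool" where
  "spherically_quasinormal T1 T2 \<longleftrightarrow>
     (\<exists>S1 S2. is_adjoint T1 S1 \<and> is_adjoint T2 S2 \<and>
        commute_on_ell2 T1 (\<lambda>f k. S1 (T1 f) k + S2 (T2 f) k) \<and>
        commute_on_ell2 T2 (\<lambda>f k. S1 (T1 f) k + S2 (T2 f) k))"

section \<open>Weighted shifts\<close>

text \<open>The weighted shift in direction \<open>d\<close>, sending the basis vector at \<open>j\<close> to \<open>w j\<close> times the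
  basis vector at \<open>j + d\<close>. By cancellation the sum has at most one term.\<close>

definition wshift :: "'a::cancel_ab_semigroup_add \<Rightarrow> ('a \<Rightarrow> real) \<Rightarrow> ('a \<Rightarrow> complex) \<Rightarrow> 'a \<Rightarrow> complex" where
  "wshift d w f k = (\<Sum>j | j + d = k. of_real (w j) * f j)"

lemma wshift_shifted [simp]: "wshift d w f (j + d) = of_real (w j) * f j"
  by (simp add: wshift_def)

lemma wshift_basis:
  "wshift d w (\<lambda>k. if k = j then 1 else 0) = (\<lambda>k. of_real (w j) * (if k = j + d then 1 else 0))"
proof
  fix k
  have "{i. i + d = k} = (if \<exists>i. i + d = k then {THE i. i + d = k} else {})"
    by (auto intro!: the_equality[symmetric])
  then have fin: "finite {i. i + d = k}" by (simp split: if_splits)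
  show "wshift d w (\<lambda>k. if k = j then 1 else 0) k = of_real (w j) * (if k = j + d then 1 else 0)"
    using fin by (auto simp: wshift_def if_distrib[of "(*) _"] sum.delta' cong: if_cong)
qed

definition bounded_positive_weights :: "('a \<Rightarrow> real) \<Rightarrow> bool" where
  "bounded_positive_weights w \<longleftrightarrow> (\<forall>k. 0 < w k) \<and> bdd_above (range w)"

abbreviation shift1 :: "(nat \<times> nat \<Rightarrow> real) \<Rightarrow> (nat \<times> nat \<Rightarrow> complex) \<Rightarrow> nat \<times> nat \<Rightarrow> complex" where
  "shift1 \<alpha> \<equiv> wshift (1, 0) \<alpha>"

abbreviation shift2 :: "(nat \<times> nat \<Rightarrow> real) \<Rightarrow> (nat \<times> nat \<Rightarrow> complex) \<Rightarrow> nat \<times> nat \<Rightarrow> complex" where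
  "shift2 \<beta> \<equiv> wshift (0, 1) \<beta>"

definition two_variable_weighted_shift :: "(nat \<times> nat \<Rightarrow> real) \<Rightarrow> (nat \<times> nat \<Rightarrow> real) \<Rightarrow> bool" where
  "two_variable_weighted_shift \<alpha> \<beta> \<longleftrightarrow>
     bounded_positive_weights \<alpha> \<and> bounded_positive_weights \<beta> \<and>
     commute_on_ell2 (shift1 \<alpha>) (shift2 \<beta>)"

definition spherical_quasinormality_constant ::
  "(nat \<times> nat \<Rightarrow> real) \<Rightarrow> (nat \<times> nat \<Rightarrow> real) \<Rightarrow> real \<Rightarrow> bool" where
  "spherical_quasinormality_constant \<alpha> \<beta> c \<longleftrightarrow> 0 < c \<and> (\<forall>k. (\<alpha> k)\<^sup>2 + (\<beta> k)\<^sup>2 = c)"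

section \<open>Moments and Berger measures\<close>

definition moment :: "(nat \<Rightarrow> real) \<Rightarrow> nat \<Rightarrow> real" where
  "moment \<omega> k = (\<Prod>i<k. (\<omega> i)\<^sup>2)"

text \<open>The moments are taken along the path that first moves horizontally and then vertically; by
  \<open>moment2_step\<close> every other nondecreasing path from the origin gives the same value.\<close>

definition moment2 :: "(nat \<times> nat \<Rightarrow> real) \<Rightarrow> (nat \<times> nat \<Rightarrow> real) \<Rightarrow> nat \<times> nat \<Rightarrow> real" where
  "moment2 \<alpha> \<beta> k = (\<Prod>i<fst k. (\<alpha> (i, 0))\<^sup>2) * (\<Prod>j<snd k. (\<beta> (fst k, j))\<^sup>2)"

lemma commuting_weights:
  assumes "commute_on_ell2 (shift1 \<alpha>) (shift2 \<beta>)"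
  shows "\<alpha> (k + (0, 1)) * \<beta> k = \<beta> (k + (1, 0)) * \<alpha> k"
proof -
  define e :: "nat \<times> nat \<Rightarrow> complex" where "e = (\<lambda>i. if i = k then 1 else 0)"
  have "(\<lambda>i. (cmod (e i))\<^sup>2) summable_on UNIV \<longleftrightarrow> (\<lambda>i. (cmod (e i))\<^sup>2) summable_on {k}"
    by (rule summable_on_cong_neutral) (auto simp: e_def)
  then have "e \<in> ell2" by (simp add: ell2_def)
  with assms have "shift1 \<alpha> (shift2 \<beta> e) (k + (0, 1) + (1, 0))
      = shift2 \<beta> (shift1 \<alpha> e) (k + (1, 0) + (0, 1))"
    by (simp add: commute_on_ell2_def add.assoc)
  then have "complex_of_real (\<alpha> (k + (0, 1)) * \<beta> k) = complex_of_real (\<beta> (k + (1, 0)) * \<alpha> k)"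
    unfolding wshift_shifted by (simp add: e_def)
  then show ?thesis by (simp only: of_real_eq_iff)
qed

lemma moment2_step:
  assumes "two_variable_weighted_shift \<alpha> \<beta>"
  shows "moment2 \<alpha> \<beta> (k + (1, 0)) = (\<alpha> k)\<^sup>2 * moment2 \<alpha> \<beta> k"
    and "moment2 \<alpha> \<beta> (k + (0, 1)) = (\<beta> k)\<^sup>2 * moment2 \<alpha> \<beta> k"
proof -
  have comm: "(\<alpha> (m, Suc n))\<^sup>2 * (\<beta> (m, n))\<^sup>2 = (\<beta> (Suc m, n))\<^sup>2 * (\<alpha> (m, n))\<^sup>2" for m n
    using commuting_weights[of \<alpha> \<beta> "(m, n)"] assms
    by (simp add: two_variable_weighted_shift_def flip: power_mult_distrib)
  obtain m n where k: "k = (m, n)" by (cases k)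
  have "(\<alpha> (m, 0))\<^sup>2 * (\<Prod>j<n. (\<beta> (Suc m, j))\<^sup>2) = (\<alpha> (m, n))\<^sup>2 * (\<Prod>j<n. (\<beta> (m, j))\<^sup>2)"
  proof (induction n)
    case (Suc n)
    have "(\<alpha> (m, 0))\<^sup>2 * (\<Prod>j<Suc n. (\<beta> (Suc m, j))\<^sup>2)
        = ((\<alpha> (m, 0))\<^sup>2 * (\<Prod>j<n. (\<beta> (Suc m, j))\<^sup>2)) * (\<beta> (Suc m, n))\<^sup>2" by simp
    also have "\<dots> = ((\<beta> (Suc m, n))\<^sup>2 * (\<alpha> (m, n))\<^sup>2) * (\<Prod>j<n. (\<beta> (m, j))\<^sup>2)"
      unfolding Suc.IH by (simp add: mult_ac)
    also have "\<dots> = (\<alpha> (m, Suc n))\<^sup>2 * (\<Prod>j<Suc n. (\<beta> (m, j))\<^sup>2)"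
      unfolding comm[symmetric] by (simp add: mult_ac)
    finally show ?case .
  qed simp
  then show "moment2 \<alpha> \<beta> (k + (1, 0)) = (\<alpha> k)\<^sup>2 * moment2 \<alpha> \<beta> k"
    by (simp add: k moment2_def mult_ac)
  show "moment2 \<alpha> \<beta> (k + (0, 1)) = (\<beta> k)\<^sup>2 * moment2 \<alpha> \<beta> k"
    by (simp add: k moment2_def mult_ac)
qed

text \<open>Berger measures are encoded as Borel probability measures on the whole line or plane that
  vanish outside the interval or rectangle on which they are supposed to live.\<close>

definition berger_measure :: "(nat \<Rightarrow> real) \<Rightarrow> real measure \<Rightarrow> bool" where
  "berger_measure \<omega> \<sigma> \<longleftrightarrow>
     prob_space \<sigma> \<and> sets \<sigma> = sets borel \<and>
     emeasure \<sigma> (- {0..(ell2_onorm (wshift 1 \<omega>))\<^sup>2}) = 0 \<and>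
     (\<forall>k. moment \<omega> k = (\<integral>s. s ^ k \<partial>\<sigma>))"

definition berger_measure2 ::
  "(nat \<times> nat \<Rightarrow> real) \<Rightarrow> (nat \<times> nat \<Rightarrow> real) \<Rightarrow> (real \<times> real) measure \<Rightarrow> bool" where
  "berger_measure2 \<alpha> \<beta> \<mu> \<longleftrightarrow>
     prob_space \<mu> \<and> sets \<mu> = sets borel \<and>
     emeasure \<mu> (- ({0..(ell2_onorm (shift1 \<alpha>))\<^sup>2} \<times> {0..(ell2_onorm (shift2 \<beta>))\<^sup>2})) = 0 \<and>
     (\<forall>k1 k2. moment2 \<alpha> \<beta> (k1, k2) = (\<integral>(s, t). s ^ k1 * t ^ k2 \<partial>\<mu>))"

text \<open>Subnormality enters through the existence of a Berger measure.\<close>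

definition recursively_generated :: "(nat \<Rightarrow> real) \<Rightarrow> bool" where
  "recursively_generated \<omega> \<longleftrightarrow>
     (\<exists>\<sigma>. berger_measure \<omega> \<sigma>) \<and>
     (\<exists>k\<ge>1. \<exists>\<phi> :: nat \<Rightarrow> real. \<forall>n. moment \<omega> (n + k) = (\<Sum>i<k. \<phi> i * moment \<omega> (n + i)))"

section \<open>Finite combinations of point masses\<close>

definition point_masses :: "nat \<Rightarrow> (nat \<Rightarrow> real) \<Rightarrow> (nat \<Rightarrow> 'a::topological_space) \<Rightarrow> 'a measure" where
  "point_masses r \<rho> x =
     measure_of UNIV (sets borel) (\<lambda>A. \<Sum>i<r. ennreal (\<rho> i) * emeasure (return borel (x i)) A)"

lemma sets_point_masses [simp]: "sets (point_masses r \<rho> x) = sets borel"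
  unfolding point_masses_def using sets.sets_measure_of_eq[of "borel :: 'a measure"] by simp

lemma emeasure_point_masses:
  assumes "A \<in> sets borel"
  shows "emeasure (point_masses r \<rho> x) A = (\<Sum>i<r. ennreal (\<rho> i) * emeasure (return borel (x i)) A)"
proof (rule emeasure_measure_of[OF point_masses_def])
  show "countably_additive (sets (point_masses r \<rho> x))
      (\<lambda>A. \<Sum>i<r. ennreal (\<rho> i) * emeasure (return borel (x i)) A)"
    unfolding countably_additive_def
  proof (intro allI impI)
    fix A :: "nat \<Rightarrow> 'a set"
    assume A: "range A \<subseteq> sets (point_masses r \<rho> x)" "disjoint_family A"
    have "emeasure (return borel (x i)) (\<Union>n. A n) = (\<Sum>n. emeasure (return borel (x i)) (A n))" for i
      using A by (intro suminf_emeasure[symmetric]) auto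
    then show "(\<Sum>n. \<Sum>i<r. ennreal (\<rho> i) * emeasure (return borel (x i)) (A n))
        = (\<Sum>i<r. ennreal (\<rho> i) * emeasure (return borel (x i)) (\<Union>n. A n))"
      by (simp add: suminf_sum ennreal_suminf_cmult)
  qed
qed (use assms in \<open>auto simp: positive_def\<close>)

end

theory Submission
  imports Defs "HOL-Computational_Algebra.Polynomial"
begin

text \<open>Spherical quasinormality says that \<open>\<gamma>(k + (1, 0)) + \<gamma>(k + (0, 1)) = c * \<gamma>(k)\<close> for the moments,
  so \<open>s + t - c\<close> is orthogonal to every polynomial in \<open>L2(\<mu>)\<close>, in particular to itself. Hence
  \<open>\<integral>(s + t - c)\<^sup>2 d\<mu> = 0\<close>, and \<open>\<mu>\<close> lives on the line \<open>s + t = c\<close>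
  (\<open>berger_measure2_on_line\<close>). A measure on that line is the image of its first marginal under
  \<open>s \<mapsto> (s, c - s)\<close>, so it remains to identify the marginal with \<open>\<sigma>\<close>.

  The marginal has the moments \<open>\<gamma>(k, 0)\<close>, which are those of \<open>\<sigma>\<close>. Since
  \<open>\<sigma>\<close> is finitely atomic, this makes the two measures equal
  (\<open>eq_point_masses_if_moments_eq\<close>): the polynomial \<open>\<Prod>i<r. (x - s\<^sub>i)\<^sup>2\<close> is nonnegative and has
  integral \<open>0\<close> against \<open>\<sigma>\<close>, hence also against the marginal, which is therefore concentrated on its
  zeros; the polynomials that vanish at all atoms but one then recover the individual masses.\<close>

section \<open>Integrals against finitely atomic measures\<close>

lemma integral_finite_support:
  fixes f :: "'a::t1_space \<Rightarrow> real"
  assumes "finite_measure M" and sets: "sets M = sets borel"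
    and F: "finite F" and ae: "AE x in M. x \<in> F" and f: "f \<in> borel_measurable borel"
  shows "integral\<^sup>L M f = (\<Sum>x\<in>F. f x * measure M {x})"
proof -
  interpret finite_measure M by fact
  have [measurable]: "f \<in> borel_measurable M" "F \<in> sets M"
    using f F by (simp_all add: measurable_cong_sets[OF sets refl] sets finite_imp_closed)
  have "integral\<^sup>L M f = (\<integral>x. f x * indicator F x \<partial>M)"
    using ae by (intro integral_cong_AE) (auto simp: indicator_def)
  also have "\<dots> = (\<Sum>x\<in>F. f x * measure M {x})"
    using F by (intro integral_indicator_finite_real) (auto simp: sets less_top[symmetric])
  finally show ?thesis .
qed

lemma emeasure_finite_support:
  fixes M :: "'a::t1_space measure"
  assumes "finite_measure M" and sets: "sets M = sets borel"
    and F: "finite F" and ae: "AE x in M. x \<in> F" and A: "A \<in> sets borel"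
  shows "emeasure M A = ennreal (\<Sum>x\<in>F. indicator A x * measure M {x})"
proof -
  interpret finite_measure M by fact
  have "measure M A = (\<integral>x. indicator A x \<partial>M)"
    using sets_eq_imp_space_eq[OF sets] by simp
  also have "\<dots> = (\<Sum>x\<in>F. indicator A x * measure M {x})"
    using A by (intro integral_finite_support[OF assms(1) sets F ae]) simp
  finally show ?thesis by (simp add: emeasure_eq_measure)
qed

lemma space_point_masses [simp]: "space (point_masses r \<rho> x) = UNIV"
  using sets_eq_imp_space_eq[OF sets_point_masses] by simp

lemma finite_measure_point_masses: "finite_measure (point_masses r \<rho> x)"
  by (rule finite_measureI) (simp add: emeasure_point_masses ennreal_mult_eq_top_iff)

lemma AE_point_masses:
  fixes x :: "nat \<Rightarrow> 'a::t1_space"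
  shows "AE y in point_masses r \<rho> x. y \<in> x ` {..<r}"
proof (rule AE_I')
  have "- x ` {..<r} \<in> sets borel"
    by (intro borel_open open_Compl finite_imp_closed) simp
  then show "- x ` {..<r} \<in> null_sets (point_masses r \<rho> x)"
    by (auto simp: null_sets_def emeasure_point_masses)
qed auto

lemma measure_point_masses_atom:
  fixes x :: "nat \<Rightarrow> 'a::t1_space"
  assumes inj: "inj_on x {..<r}" and "0 \<le> \<rho> i" and i: "i < r"
  shows "measure (point_masses r \<rho> x) {x i} = \<rho> i"
proof -
  have "emeasure (point_masses r \<rho> x) {x i} = (\<Sum>j<r. if j = i then ennreal (\<rho> j) else 0)"
    unfolding emeasure_point_masses[OF borel_singleton[OF sets.empty_sets]]
    using inj i by (intro sum.cong) (auto simp: inj_on_def indicator_def)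
  also have "\<dots> = ennreal (\<rho> i)" using i by simp
  finally show ?thesis using assms(2) by (simp add: measure_def)
qed

lemma integral_point_masses:
  fixes x :: "nat \<Rightarrow> 'a::t1_space" and f :: "'a \<Rightarrow> real"
  assumes inj: "inj_on x {..<r}" and nonneg: "\<And>i. i < r \<Longrightarrow> 0 \<le> \<rho> i"
    and f: "f \<in> borel_measurable borel"
  shows "integral\<^sup>L (point_masses r \<rho> x) f = (\<Sum>i<r. \<rho> i * f (x i))"
  using inj nonneg
  by (subst integral_finite_support[OF finite_measure_point_masses sets_point_masses _ AE_point_masses f])
    (auto simp: sum.reindex measure_point_masses_atom mult.commute intro!: sum.cong)

lemma distr_point_masses:
  assumes "g \<in> borel_measurable borel"
  shows "distr (point_masses r \<rho> x) borel g = point_masses r \<rho> (\<lambda>i. g (x i))"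
proof (rule measure_eqI)
  fix A assume A: "A \<in> sets (distr (point_masses r \<rho> x) borel g)"
  have g: "g \<in> measurable (point_masses r \<rho> x) borel"
    using assms by (simp add: measurable_cong_sets[OF sets_point_masses refl])
  have "g -` A \<in> sets borel" using measurable_sets[OF assms, of A] A by simp
  then show "emeasure (distr (point_masses r \<rho> x) borel g) A
      = emeasure (point_masses r \<rho> (\<lambda>i. g (x i))) A"
    using A by (simp add: emeasure_distr[OF g] emeasure_point_masses indicator_def)
qed simp

section \<open>Moment determinacy of finitely atomic measures\<close>

text \<open>Equality of moments is equality of the integrals of all polynomials. The square of the
  polynomial with simple zeros at the atoms confines \<open>M\<close> to the atoms, and polynomials separate
  finitely many points.\<close>

theorem eq_point_masses_if_moments_eq:
  fixes M :: "real measure"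
  assumes fin: "finite_measure M" and sets: "sets M = sets borel"
    and int: "\<And>k. integrable M (\<lambda>x. x ^ k)"
    and inj: "inj_on s {..<r}" and nonneg: "\<And>i. i < r \<Longrightarrow> 0 \<le> \<rho> i"
    and moments: "\<And>k. (\<integral>x. x ^ k \<partial>M) = (\<Sum>i<r. \<rho> i * s i ^ k)"
  shows "M = point_masses r \<rho> s"
proof -
  interpret finite_measure M by fact
  have int_poly: "integrable M (poly p)" for p
    unfolding poly_altdef[abs_def] by (intro Bochner_Integration.integrable_sum integrable_mult_right int)
  have poly_integral: "(\<integral>x. poly p x \<partial>M) = (\<Sum>i<r. \<rho> i * poly p (s i))" for p
    by (simp add: poly_altdef Bochner_Integration.integral_sum int moments sum_distrib_left
        sum.swap[of _ "{..<r}"] mult_ac)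
  define p where "p = (\<Prod>i<r. [:- s i, 1:]) ^ 2"
  have "(\<integral>x. poly p x \<partial>M) = 0"
    unfolding poly_integral by (intro sum.neutral) (auto simp: p_def poly_prod)
  then have "AE x in M. poly p x = 0"
    by (subst (asm) integral_nonneg_eq_0_iff_AE[OF int_poly]) (auto simp: p_def)
  then have ae: "AE x in M. x \<in> s ` {..<r}"
    by eventually_elim (auto simp: p_def poly_prod)
  have atom: "measure M {s i} = \<rho> i" if i: "i < r" for i
  proof -
    \<comment> \<open>Up to a factor, the Lagrange polynomial of the node \<open>s i\<close>.\<close>
    define q where "q = (\<Prod>j\<in>{..<r} - {i}. [:- s j, 1:])"
    have q0: "poly q (s j) = 0" if "j < r" "j \<noteq> i" for j
      using that by (auto simp: q_def poly_prod)
    have qi: "poly q (s i) \<noteq> 0"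
      using i inj by (auto simp: q_def poly_prod inj_on_def)
    have "(\<integral>x. poly q x \<partial>M) = (\<Sum>j<r. poly q (s j) * measure M {s j})"
      by (subst integral_finite_support[OF fin sets _ ae])
        (auto simp: sum.reindex[OF inj] intro!: borel_measurable_continuous_onI continuous_intros)
    also have "\<dots> = (\<Sum>j<r. if j = i then poly q (s i) * measure M {s i} else 0)"
      by (intro sum.cong) (auto simp: q0)
    also have "\<dots> = poly q (s i) * measure M {s i}" using i by simp
    finally have 1: "(\<integral>x. poly q x \<partial>M) = poly q (s i) * measure M {s i}" .
    have "(\<integral>x. poly q x \<partial>M) = (\<Sum>j<r. if j = i then \<rho> i * poly q (s i) else 0)"
      unfolding poly_integral by (intro sum.cong) (auto simp: q0)
    also have "\<dots> = \<rho> i * poly q (s i)" using i by simp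
    finally show ?thesis using 1 qi by simp
  qed
  show ?thesis
  proof (rule measure_eqI)
    fix A assume "A \<in> sets M"
    then have A: "A \<in> sets borel" by (simp add: sets)
    show "emeasure M A = emeasure (point_masses r \<rho> s) A"
      by (subst emeasure_finite_support[OF fin sets _ ae A], simp,
          subst emeasure_finite_support[OF finite_measure_point_masses sets_point_masses
            _ AE_point_masses A], simp,
          intro arg_cong[where f = ennreal] sum.cong)
        (auto simp: atom measure_point_masses_atom[OF inj nonneg])
  qed (simp add: sets)
qed

section \<open>The Berger measure of a spherically quasinormal shift\<close>

lemma integrable_continuous_compact_support:
  fixes f :: "'a::topological_space \<Rightarrow> real"
  assumes "finite_measure M" and sets: "sets M = sets borel"
    and "compact K" and ae: "AE x in M. x \<in> K" and cont: "continuous_on UNIV f"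
  shows "integrable M f"
proof -
  interpret finite_measure M by fact
  have "compact (f ` K)"
    using assms by (intro compact_continuous_image continuous_on_subset[OF cont]) auto
  then obtain B where "\<forall>x\<in>K. norm (f x) \<le> B"
    by (auto dest!: compact_imp_bounded simp: bounded_iff)
  with ae have "AE x in M. norm (f x) \<le> B" by auto
  moreover have "f \<in> borel_measurable M"
    using borel_measurable_continuous_onI[OF cont] by (simp add: measurable_cong_sets[OF sets refl])
  ultimately show ?thesis by (rule integrable_const_bound)
qed

lemma
  assumes "berger_measure2 \<alpha> \<beta> \<mu>"
  shows berger_measure2_prob_space: "prob_space \<mu>"
    and berger_measure2_sets: "sets \<mu> = sets borel"
    and berger_measure2_moment: "(\<integral>z. fst z ^ m * snd z ^ n \<partial>\<mu>) = moment2 \<alpha> \<beta> (m, n)"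
  using assms by (simp_all add: berger_measure2_def case_prod_unfold)

lemma berger_measure2_integrable:
  fixes f :: "real \<times> real \<Rightarrow> real"
  assumes \<mu>: "berger_measure2 \<alpha> \<beta> \<mu>" and "continuous_on UNIV f"
  shows "integrable \<mu> f"
proof -
  let ?K = "{0..(ell2_onorm (shift1 \<alpha>))\<^sup>2} \<times> {0..(ell2_onorm (shift2 \<beta>))\<^sup>2}"
  have "closed ?K" by (intro closed_Times) auto
  then have "- ?K \<in> null_sets \<mu>"
    using \<mu> by (auto simp: berger_measure2_def null_sets_def)
  then have "AE z in \<mu>. z \<in> ?K"
    by (rule AE_I') auto
  moreover have "compact ?K" by (intro compact_Times) auto
  moreover have "finite_measure \<mu>"
    using berger_measure2_prob_space[OF \<mu>] by (rule prob_space.finite_measure)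
  ultimately show ?thesis
    using berger_measure2_sets[OF \<mu>] assms(2) by (intro integrable_continuous_compact_support)
qed

text \<open>The recursion for the moments makes the defect \<open>s + t - c\<close> orthogonal to all monomials; it is
  itself a combination of \<open>s\<close>, \<open>t\<close> and \<open>1\<close>, so its \<open>L2\<close> norm vanishes.\<close>

theorem berger_measure2_on_line:
  assumes shift: "two_variable_weighted_shift \<alpha> \<beta>"
    and c: "spherical_quasinormality_constant \<alpha> \<beta> c"
    and \<mu>: "berger_measure2 \<alpha> \<beta> \<mu>"
  shows "AE z in \<mu>. fst z + snd z = c"
proof -
  note int = berger_measure2_integrable[OF \<mu>]
  define d where "d = (\<lambda>z :: real \<times> real. fst z + snd z - c)"
  have orth: "(\<integral>z. (fst z ^ m * snd z ^ n) * d z \<partial>\<mu>) = 0" for m n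
  proof -
    have "(\<integral>z. (fst z ^ m * snd z ^ n) * d z \<partial>\<mu>)
        = (\<integral>z. fst z ^ Suc m * snd z ^ n + fst z ^ m * snd z ^ Suc n
              - c * (fst z ^ m * snd z ^ n) \<partial>\<mu>)"
      by (simp add: d_def algebra_simps)
    also have "\<dots> = (\<integral>z. fst z ^ Suc m * snd z ^ n \<partial>\<mu>) + (\<integral>z. fst z ^ m * snd z ^ Suc n \<partial>\<mu>)
        - c * (\<integral>z. fst z ^ m * snd z ^ n \<partial>\<mu>)"
      by (subst Bochner_Integration.integral_diff Bochner_Integration.integral_add
            integral_mult_right_zero; (intro int continuous_intros)?)+ simp
    also have "\<dots> = ((\<alpha> (m, n))\<^sup>2 + (\<beta> (m, n))\<^sup>2 - c) * moment2 \<alpha> \<beta> (m, n)"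
      using moment2_step[OF shift, of "(m, n)"]
      by (simp only: berger_measure2_moment[OF \<mu>]) (simp add: algebra_simps)
    also have "\<dots> = 0"
      using c by (simp add: spherical_quasinormality_constant_def)
    finally show ?thesis .
  qed
  have "(\<integral>z. (d z)\<^sup>2 \<partial>\<mu>) = (\<integral>z. fst z * d z + snd z * d z - c * d z \<partial>\<mu>)"
    by (simp add: d_def power2_eq_square algebra_simps)
  also have "\<dots> = (\<integral>z. fst z * d z \<partial>\<mu>) + (\<integral>z. snd z * d z \<partial>\<mu>) - c * (\<integral>z. d z \<partial>\<mu>)"
    unfolding d_def
    by (subst Bochner_Integration.integral_diff Bochner_Integration.integral_add
          integral_mult_right_zero; (intro int continuous_intros)?)+ simp
  also have "\<dots> = 0"
    using orth[of 1 0] orth[of 0 1] orth[of 0 0] by simp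
  finally have "(\<integral>z. (d z)\<^sup>2 \<partial>\<mu>) = 0" .
  then have "AE z in \<mu>. (d z)\<^sup>2 = 0"
    by (subst (asm) integral_nonneg_eq_0_iff_AE) (auto simp: d_def intro!: int continuous_intros)
  then show ?thesis by eventually_elim (simp add: d_def)
qed

theorem theorem6p1:
  fixes \<alpha> \<beta> :: "nat \<times> nat \<Rightarrow> real"
    and c :: real
    and \<mu> :: "(real \<times> real) measure"
    and \<sigma> :: "real measure"
    and r :: nat
    and \<rho> s :: "nat \<Rightarrow> real"
  assumes "two_variable_weighted_shift \<alpha> \<beta>"
    and "spherically_quasinormal (shift1 \<alpha>) (shift2 \<beta>)"
    and "spherical_quasinormality_constant \<alpha> \<beta> c"
    and "berger_measure2 \<alpha> \<beta> \<mu>"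
    and "berger_measure (\<lambda>n. \<alpha> (n, 0)) \<sigma>"
    and "recursively_generated (\<lambda>n. \<alpha> (n, 0))"
    and "\<sigma> = point_masses r \<rho> s"
    and "strict_mono_on {..<r} s"
    and "\<And>i. i < r \<Longrightarrow> 0 \<le> s i \<and> s i \<le> c"
    and "\<And>i. i < r \<Longrightarrow> 0 < \<rho> i"
    and "(\<Sum>i<r. \<rho> i) = 1"
  shows "\<mu> = point_masses r \<rho> (\<lambda>i. (s i, c - s i))"
proof -
  note \<mu> = assms(4)
  interpret \<mu>: prob_space \<mu> using berger_measure2_prob_space[OF \<mu>] .
  have sets: "sets \<mu> = sets borel" using berger_measure2_sets[OF \<mu>] .
  have fst_meas: "fst \<in> measurable \<mu> borel"
    unfolding measurable_cong_sets[OF sets refl]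
    by (intro borel_measurable_continuous_onI continuous_intros)
  define \<nu> where "\<nu> = distr \<mu> borel fst"
  define g where "g = (\<lambda>x :: real. (x, c - x))"
  have g_meas: "g \<in> borel_measurable borel"
    unfolding g_def by (intro borel_measurable_continuous_onI continuous_intros)
  have inj: "inj_on s {..<r}"
    using assms(8) by (rule strict_mono_on_imp_inj_on)
  have "\<nu> = point_masses r \<rho> s"
  proof (rule eq_point_masses_if_moments_eq[OF _ _ _ inj])
    show "finite_measure \<nu>"
      unfolding \<nu>_def by (rule \<mu>.finite_measure_distr[OF fst_meas])
    show "integrable \<nu> (\<lambda>x. x ^ k)" for k
      unfolding \<nu>_def
      by (subst integrable_distr_eq[OF fst_meas])
        (auto intro!: berger_measure2_integrable[OF \<mu>] continuous_intros)
    have "(\<integral>x. x ^ k \<partial>\<nu>) = (\<integral>z. fst z ^ k * snd z ^ 0 \<partial>\<mu>)" for k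
      unfolding \<nu>_def by (subst integral_distr[OF fst_meas]) auto
    also have "\<dots> k = moment (\<lambda>n. \<alpha> (n, 0)) k" for k
      by (simp only: berger_measure2_moment[OF \<mu>]) (simp add: moment2_def moment_def)
    also have "\<dots> k = (\<integral>x. x ^ k \<partial>point_masses r \<rho> s)" for k
      using assms(5,7) by (simp add: berger_measure_def)
    also have "\<dots> k = (\<Sum>i<r. \<rho> i * s i ^ k)" for k
      using assms(10) by (intro integral_point_masses[OF inj]) (auto intro: less_imp_le)
    finally show "(\<integral>x. x ^ k \<partial>\<nu>) = (\<Sum>i<r. \<rho> i * s i ^ k)" for k .
  qed (use assms(10) in \<open>auto simp: \<nu>_def intro: less_imp_le\<close>)
  moreover have "\<mu> = distr \<nu> borel g"
  proof -
    have "distr \<nu> borel g = distr \<mu> borel (\<lambda>z. g (fst z))"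
      unfolding \<nu>_def by (simp add: distr_distr[OF g_meas fst_meas] comp_def)
    also have "\<dots> = distr \<mu> borel (\<lambda>z. z)"
    proof (rule distr_cong_AE)
      show "AE z in \<mu>. g (fst z) = z"
        using berger_measure2_on_line[OF assms(1,3) \<mu>] by eventually_elim (auto simp: g_def)
      show "(\<lambda>z. g (fst z)) \<in> measurable \<mu> borel"
        using g_meas fst_meas by (rule measurable_compose[rotated])
      show "(\<lambda>z. z) \<in> measurable \<mu> borel"
        using sets by (intro measurable_ident_sets)
    qed simp_all
    also have "\<dots> = \<mu>" using sets by (intro distr_id2) simp
    finally show ?thesis ..
  qed
  ultimately show ?thesis
    using distr_point_masses[OF g_meas, of r \<rho> s] by (simp add: g_def)
qed

end
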